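(* Let $T(z,w)=\sum_{n\ge1}\sum_{t\ge0}T(n,t)\,w^t z^n$. Define $\psi_0(z)=1-2z(1-w)$, $\psi_1(z)=\sqrt{1-4z(1-w)}$, and $\psi_j(z)=\sqrt{2\psi_{j-1}(z)-1}$ for $j\ge2$. Then $$T(z,w)=\sum_{j\ge0}\frac{\psi_j(z)-\psi_{j+1}(z)}{2z(1-w)}\,w^j.$$
   Context: Multi-pass stack sorting: in a pass, the entries of the current input are pushed one at a time, in order, onto a stack; whenever the top of the stack is the smallest value not yet output, it is popped to the output (repeatedly); entries are never popped otherwise. When all input entries have been pushed and no pop is possible, if the stack is nonempty the remaining entries are returned to the input in their original relative order and a new pass begins. The tier of a permutation is one less than the minimum number of passes needed to output $1,\dots,n$. $T(n,t)$ denotes the number of permutations of length $n$ with tier $t$. Square roots denote the formal power series with constant term $1$. *)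

theory Defs
  imports
    "HOL-Computational_Algebra.Formal_Power_Series"
    "HOL-Combinatorics.Multiset_Permutations"
begin

section \<open>Multi-pass stack sorting\<close>

text \<open>
  Permutations of length \<open>n\<close> are written in one-line notation, i.e. they are the
  elements of \<^term>\<open>permutations_of_set {1..n}\<close>. The head of the stack list is its top.
  The values not yet output are those still in the input or on the stack; this is how
  ``the smallest value not yet output'' is expressed below.
\<close>

fun pop_all :: "nat list \<Rightarrow> nat list \<Rightarrow> nat list \<Rightarrow> nat list \<times> nat list" where
  "pop_all inp [] out = ([], out)"
| "pop_all inp (x # stk) out =
     (if x = Min (set inp \<union> set (x # stk)) then pop_all inp stk (out @ [x])
      else (x # stk, out))"

fun push_all :: "nat list \<Rightarrow> nat list \<Rightarrow> nat list \<Rightarrow> nat list \<times> nat list" where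
  "push_all [] stk out = (stk, out)"
| "push_all (x # inp) stk out =
     (case pop_all inp (x # stk) out of (stk', out') \<Rightarrow> push_all inp stk' out')"

text \<open>
  Read from bottom to top, the entries left on the stack are in their original relative
  order; hence the reversal when they are returned to the input.
\<close>

definition sort_pass :: "nat list \<times> nat list \<Rightarrow> nat list \<times> nat list" where
  "sort_pass = (\<lambda>(inp, out). case push_all inp [] out of (stk, out') \<Rightarrow> (rev stk, out'))"

definition passes_needed :: "nat list \<Rightarrow> nat" where
  "passes_needed p =
     (LEAST m. snd ((sort_pass ^^ m) (p, [])) = [1..<Suc (length p)])"

definition tier :: "nat list \<Rightarrow> nat" where
  "tier p = passes_needed p - 1"

definition tier_count :: "nat \<Rightarrow> nat \<Rightarrow> nat" where
  "tier_count n t = card {p \<in> permutations_of_set {1..n}. tier p = t}"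


section \<open>Bivariate generating functions\<close>

text \<open>
  The ring of formal power series in \<open>z\<close> and \<open>w\<close> over the rationals is represented as
  \<^typ>\<open>rat fps fps\<close>: the outer variable is \<open>z\<close> and the coefficients are series in \<open>w\<close>.
\<close>

definition Z :: "rat fps fps" where
  "Z = fps_X"

definition W :: "rat fps fps" where
  "W = fps_const fps_X"

definition tier_gf :: "rat fps fps" where
  "tier_gf = Abs_fps (\<lambda>n. if n = 0 then 0 else Abs_fps (\<lambda>t. of_nat (tier_count n t)))"

definition fps_sqrt :: "rat fps fps \<Rightarrow> rat fps fps" where
  "fps_sqrt f = (THE g. g ^ 2 = f \<and> fps_nth (fps_nth g 0) 0 = 1)"

fun \<psi> :: "nat \<Rightarrow> rat fps fps" where
  "\<psi> 0 = 1 - 2 * Z * (1 - W)"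
| "\<psi> (Suc 0) = fps_sqrt (1 - 4 * Z * (1 - W))"
| "\<psi> (Suc (Suc j)) = fps_sqrt (2 * \<psi> (Suc j) - 1)"

text \<open>
  The terms of the sum over \<open>j\<close> in the main formula tend to \<open>0\<close> because of the factor \<open>w\<^sup>j\<close>,
  not because of their order in \<open>z\<close>, whereas the library's metric on \<^typ>\<open>rat fps fps\<close> sees
  only the order in the outer variable \<open>z\<close>. The sum is therefore taken separately in the
  coefficient of each \<open>z\<^sup>n\<close>, in the usual topology of \<^typ>\<open>rat fps\<close>. This is coefficientwise
  convergence, i.e. convergence in the usual topology of the power series ring in \<open>z\<close> and \<open>w\<close>.
\<close>

text \<open>
  The description operator in \<^const>\<open>fps_sqrt\<close> is well defined on all series occurring
  under a root, since these have \<open>1\<close> as their coefficient of \<open>z\<^sup>0\<close>.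
\<close>

fun sqrt_coeff :: "rat fps fps \<Rightarrow> nat \<Rightarrow> rat fps" where
  "sqrt_coeff f n =
     (if n = 0 then 1
      else fps_const (1/2) *
        (fps_nth f n - (\<Sum>k\<in>{1..<n}. sqrt_coeff f k * sqrt_coeff f (n - k))))"

declare sqrt_coeff.simps [simp del]

lemma fps_sqrt_ex1:
  fixes f :: "rat fps fps"
  assumes "fps_nth f 0 = 1"
  shows "\<exists>!g. g ^ 2 = f \<and> fps_nth (fps_nth g 0) 0 = 1"
proof (rule ex_ex1I)
  define c where "c = sqrt_coeff f"
  have c0: "c 0 = 1"
    by (simp add: c_def sqrt_coeff.simps)
  have "(\<Sum>k=0..n. c k * c (n - k)) = fps_nth f n" for n
  proof (cases "n = 0")
    case True
    then show ?thesis using c0 assms by simp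
  next
    case False
    have two: "x + x = fps_const 2 * x" for x :: "rat fps"
      by (metis fps_numeral_fps_const mult_2)
    have "{0..n} = insert 0 (insert n {1..<n})"
      using False by auto
    then have "(\<Sum>k=0..n. c k * c (n - k)) =
        c n + c n + (\<Sum>k\<in>{1..<n}. c k * c (n - k))"
      using False c0 by simp
    also have "c n + c n = fps_nth f n - (\<Sum>k\<in>{1..<n}. c k * c (n - k))"
      unfolding two using False sqrt_coeff.simps[of f n]
      by (simp add: c_def mult.assoc[symmetric])
    finally show ?thesis by simp
  qed
  then have "Abs_fps c ^ 2 = f"
    by (intro fps_ext) (simp add: power2_eq_square fps_mult_nth)
  then show "\<exists>g. g ^ 2 = f \<and> fps_nth (fps_nth g 0) 0 = 1"
    using c0 by (intro exI[of _ "Abs_fps c"]) simp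
next
  fix g h :: "rat fps fps"
  assume "g ^ 2 = f \<and> fps_nth (fps_nth g 0) 0 = 1" "h ^ 2 = f \<and> fps_nth (fps_nth h 0) 0 = 1"
  then have "g = h \<or> g = - h" and "fps_nth (fps_nth g 0) 0 = fps_nth (fps_nth h 0) 0"
    and "fps_nth (fps_nth h 0) 0 = 1"
    by (auto simp: power2_eq_iff)
  then show "g = h" by auto
qed

text \<open>
  Division of power series is specified in the library chiefly over fields. Here the
  divisor \<open>2 z (1 - w)\<close> is \<open>z\<close> times a unit, and division by it is exact on every
  series divisible by \<open>z\<close>.
\<close>

lemma mult_divide_2ZW:
  assumes "fps_nth f 0 = 0"
  shows "2 * Z * (1 - W) * (f / (2 * Z * (1 - W))) = f"
proof -
  define u :: "rat fps" where "u = 2 * (1 - fps_X)"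
  have u0: "fps_nth u 0 \<noteq> 0"
    by (simp add: u_def fps_numeral_fps_const)
  then have u: "u \<noteq> 0" by auto
  have d: "2 * Z * (1 - W) = fps_const u * fps_X"
    by (simp add: Z_def W_def u_def fps_numeral_fps_const mult_ac flip: fps_const_mult fps_const_sub)
  have sd: "subdegree (fps_const u * fps_X) = 1"
    using u by (intro subdegreeI) auto
  have uf: "unit_factor (fps_const u * fps_X) = fps_const u"
    by (simp only: fps_unit_factor_def sd) (rule fps_ext, simp)
  have inv: "fps_const u * inverse (fps_const u) = 1"
    unfolding fps_inverse_def[of "fps_const u"]
    using fps_right_inverse[of "fps_const u" "inverse u"] inverse_mult_eq_1'[OF u0]
    by (simp add: fps_inverse_def)
  have shift: "fps_X * fps_shift 1 h = h" if "fps_nth h 0 = 0" for h :: "rat fps fps"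
    using that by (intro fps_ext) (auto simp: fps_X_mult_nth)
  have "fps_const u * fps_X * (f / (fps_const u * fps_X)) =
      fps_const u * (fps_X * fps_shift 1 (f * inverse (fps_const u)))"
    by (simp only: fps_divide_def sd uf mult.assoc)
  also have "\<dots> = (fps_const u * inverse (fps_const u)) * f"
    using assms by (subst shift) (simp_all add: mult_ac)
  finally show ?thesis by (simp add: inv d)
qed

end

theory Submission
  imports Defs
begin

text \<open>
  Deleting the smallest value \<open>a\<close> from the input either leaves the first pass unchanged up to the
  output of \<open>a\<close>, or, if the next value \<open>b\<close> stands to the left of \<open>a\<close> with a larger entry in between,
  saves exactly one pass, because \<open>b\<close> is then buried when \<open>a\<close> is popped. Hence the tier is the
  number of such adjacent values. Building a permutation by inserting its values in decreasing
  order turns it into a sequence of insertion positions, each at most the number of values already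
  present, and the tier into the number of increases by at least two. Inclusion-exclusion over
  these increases gives, for \<open>P\<^sub>n(w) = \<Sum>\<^sub>t T(n,t) w\<^sup>t\<close> with \<open>P\<^sub>0 = 1\<close>, the recurrence
  \<open>P\<^sub>n = \<Sum>\<^sub>k (w - 1)\<^bsup>k - 1\<^esup> binom(n + 1 - k, k) P\<^bsub>n - k\<^esub>\<close> over \<open>1 \<le> k \<le> n\<close>.

  On the other side, let \<open>c\<close> be the compositional inverse of \<open>x - x\<^sup>2\<close> and \<open>c\<^sub>j\<close> its \<open>j\<close>-th iterate.
  Then \<open>\<psi>\<^sub>j = 1 - 2 c\<^sub>j(z (1 - w))\<close>, so the sum in question is determined by
  \<open>G(x) = \<Sum>\<^sub>j w\<^sup>j c\<^bsub>j + 1\<^esub>(x)\<close>. This series satisfies \<open>G(x - x\<^sup>2) = x + w G(x)\<close>, which is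
  the same recurrence for its coefficients after multiplication by powers of \<open>1 - w\<close>.
\<close>

section \<open>Insertion sequences of permutations\<close>

fun insertion_seqs :: "nat \<Rightarrow> nat list set" where
  "insertion_seqs 0 = {[]}"
| "insertion_seqs (Suc n) = (\<lambda>(e, es). e # es) ` ({..n} \<times> insertion_seqs n)"

fun build :: "nat \<Rightarrow> nat list \<Rightarrow> nat list" where
  "build k [] = []"
| "build k (e # es) = take e (build (Suc k) es) @ k # drop e (build (Suc k) es)"

text \<open>\<open>e\<close> and \<open>d\<close> are the positions of two consecutive values, the
  smaller first, each at the moment of its insertion. So \<open>d + 2 \<le> e\<close> says that the
  smaller one stands to the right of the other with an already present, hence larger, entry in
  between.\<close>

fun jumps :: "nat list \<Rightarrow> nat" where
  "jumps (e # d # es) = (if d + 2 \<le> e then 1 else 0) + jumps (d # es)"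
| "jumps es = 0"

lemma finite_insertion_seqs [simp]: "finite (insertion_seqs n)"
  by (induction n) auto

lemma length_insertion_seqs: "es \<in> insertion_seqs n \<Longrightarrow> length es = n"
  by (induction n arbitrary: es) auto

lemma length_build [simp]: "length (build k es) = length es"
  by (induction es arbitrary: k) auto

lemma build_permutation:
  "build k es \<in> permutations_of_set {k..<k + length es}"
proof (induction es arbitrary: k)
  case (Cons e es)
  let ?p = "build (Suc k) es"
  have p: "set ?p = {Suc k..<Suc k + length es}" "distinct ?p"
    using Cons[of "Suc k"] by (auto simp: permutations_of_set_def)
  have s: "set (take e ?p) \<union> set (drop e ?p) = set ?p"
    by (metis append_take_drop_id set_append)
  have "set (build k (e # es)) = insert k (set ?p)"
    using s by auto
  also have "\<dots> = {k..<k + length (e # es)}"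
    unfolding p(1) by auto
  finally have *: "set (build k (e # es)) = {k..<k + length (e # es)}" .
  have "k \<notin> set ?p" using p by auto
  then have "distinct (build k (e # es))"
    using p(2) s set_take_disj_set_drop_if_distinct[OF p(2), of e e] by auto
  with * show ?case by (simp add: permutations_of_set_def)
qed (simp add: permutations_of_set_def)

lemma set_build: "set (build k es) = {k..<k + length es}"
  and distinct_build: "distinct (build k es)"
  using build_permutation[of k es] by (auto simp: permutations_of_set_def)

lemma inj_on_build: "inj_on (build k) (insertion_seqs n)"
proof (induction n arbitrary: k)
  case (Suc n)
  show ?case
  proof (rule inj_onI)
    fix xs ys assume "xs \<in> insertion_seqs (Suc n)" "ys \<in> insertion_seqs (Suc n)"
      and eq: "build k xs = build k ys"
    then obtain d ds e es where xs: "xs = d # ds" "d \<le> n" "ds \<in> insertion_seqs n"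
      and ys: "ys = e # es" "e \<le> n" "es \<in> insertion_seqs n" by auto
    let ?p = "build (Suc k) ds" and ?q = "build (Suc k) es"
    have "k \<notin> set ?p" "k \<notin> set ?q" by (auto simp: set_build)
    then have "k \<notin> set (take d ?p)" "k \<notin> set (drop d ?p)" "k \<notin> set (take e ?q)"
      by (meson in_set_takeD in_set_dropD)+
    with eq have t: "take d ?p = take e ?q" "drop d ?p = drop e ?q"
      unfolding xs ys by (auto simp: append_Cons_eq_iff)
    then have "?p = ?q" by (metis append_take_drop_id)
    moreover have "length (take d ?p) = d" "length (take e ?q) = e"
      using xs ys length_insertion_seqs by auto
    ultimately show "xs = ys"
      using Suc[of "Suc k"] xs ys t by (metis inj_onD)
  qed
qed auto

lemma build_image: "build k ` insertion_seqs n = permutations_of_set {k..<k + n}"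
proof
  show "build k ` insertion_seqs n \<subseteq> permutations_of_set {k..<k + n}"
    using build_permutation length_insertion_seqs by auto
  show "permutations_of_set {k..<k + n} \<subseteq> build k ` insertion_seqs n"
  proof (induction n arbitrary: k)
    case (Suc n)
    show ?case
    proof
      fix p assume "p \<in> permutations_of_set {k..<k + Suc n}"
      then have p: "set p = {k..<k + Suc n}" "distinct p"
        by (auto simp: permutations_of_set_def)
      then have "k \<in> set p" by auto
      then obtain u v where uv: "p = u @ k # v" by (meson split_list)
      have k: "k \<notin> set u" "k \<notin> set v" using p(2) uv by auto
      have "set (u @ v) = set p - {k}" using k uv by auto
      also have "\<dots> = {Suc k..<Suc k + n}" unfolding p(1) by auto
      finally have s: "set (u @ v) = {Suc k..<Suc k + n}" .
      then have "u @ v \<in> permutations_of_set {Suc k..<Suc k + n}"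
        using p(2) uv by (auto simp: permutations_of_set_def)
      then obtain es where es: "es \<in> insertion_seqs n" "u @ v = build (Suc k) es"
        using Suc[of "Suc k"] by blast
      have "length u \<le> n"
        using es length_insertion_seqs by (metis length_append length_build le_add1)
      moreover have "p = build k (length u # es)"
        using uv by (simp flip: es(2))
      ultimately show "p \<in> build k ` insertion_seqs (Suc n)"
        using es(1) by (intro image_eqI[of _ _ "length u # es"]) auto
    qed
  qed simp
qed

section \<open>One pass after insertion of a new minimum\<close>

lemma push_all_above_input_min:
  assumes "\<forall>x \<in> set u \<union> set stk. a < x"
  shows "push_all (u @ a # v) stk out = push_all (a # v) (rev u @ stk) out"
  using assms
proof (induction u arbitrary: stk)
  case (Cons x u)
  have "Min (set (u @ a # v) \<union> set (x # stk)) \<le> a"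
    by (rule Min_le) auto
  then have "pop_all (u @ a # v) (x # stk) out = (x # stk, out)"
    using Cons.prems by auto
  then show ?case using Cons by simp
qed simp

lemma push_all_min_first:
  assumes "\<forall>x \<in> set (u @ v). a < x"
  shows "push_all (u @ a # v) [] out =
    (case pop_all v (rev u) (out @ [a]) of (stk, out') \<Rightarrow> push_all v stk out')"
proof -
  have "Min (set v \<union> set (a # rev u)) = a"
    using assms by (intro Min_eqI) (auto simp: less_imp_le)
  then show ?thesis
    using assms push_all_above_input_min[of u "[]" a v out] by simp
qed

lemma pop_all_stuck:
  assumes "b \<in> set v \<union> set stk" "b < x"
  shows "pop_all v (x # stk) out = (x # stk, out)"
proof -
  have "Min (set v \<union> set (x # stk)) \<le> b"
    using assms by (intro Min_le) auto
  then have "x \<noteq> Min (set v \<union> set (x # stk))" using assms(2) by linarith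
  then show ?thesis by simp
qed

text \<open>\<open>b\<close> stays on the stack beneath all that is pushed, so no new entry is ever
  the minimum.\<close>

lemma push_all_stuck:
  assumes "b \<in> set stk" "\<forall>x \<in> set v. b < x"
  shows "push_all v stk out = (rev v @ stk, out)"
  using assms
proof (induction v arbitrary: stk)
  case (Cons x v)
  then show ?case using pop_all_stuck[of b v stk x out] by simp
qed simp

text \<open>\<open>b\<close> is the next value to leave after \<open>a\<close>. Only a larger entry
  between \<open>b\<close> and a later \<open>a\<close> keeps it from leaving in this pass.\<close>

lemma sort_pass_remove_min:
  assumes p: "p = u' @ b # v'" and b: "\<forall>x \<in> set (u' @ v'). b < x" and "a < b"
    and e: "e \<le> length p"
  shows "sort_pass (take e p @ a # drop e p, out) =
    (if length u' + 2 \<le> e then (p, out @ [a]) else sort_pass (p, out @ [a]))"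
proof -
  define u v where "u = take e p" and "v = drop e p"
  have p_uv: "p = u @ v" by (simp add: u_def v_def)
  have "\<forall>x \<in> set (u @ v). a < x"
    using b \<open>a < b\<close> p by (fold p_uv) (auto intro: less_trans)
  note first = push_all_min_first[OF this, of out]
  consider "e \<le> length u'" | "e = length u' + 1" | "length u' + 2 \<le> e" by linarith
  then show ?thesis
  proof cases
    \<comment> \<open>\<open>a\<close> stands left of \<open>b\<close>: as \<open>b\<close> is still
      in the input, popping \<open>a\<close> triggers no further pop, and the pass goes on as for
      \<open>p\<close> alone.\<close>
    case 1
    define w where "w = drop e u'"
    have u: "u' = u @ w" and v: "v = w @ b # v'"
      using 1 by (auto simp: u_def v_def w_def p)
    have pop: "pop_all v (rev u) o' = (rev u, o')" for o'
    proof (cases "rev u")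
      case (Cons x xs)
      then have "x \<in> set u" by (metis list.set_intros(1) set_rev)
      then show ?thesis
        unfolding Cons using b u v by (intro pop_all_stuck[of b]) auto
    qed simp
    have "push_all ((u @ w) @ b # v') [] o' = push_all (b # v') (rev (u @ w) @ []) o'"
      "push_all (w @ b # v') (rev u) o' = push_all (b # v') (rev w @ rev u) o'" for o'
      by (rule push_all_above_input_min; use b u in auto)+
    then have "push_all (u @ v) [] o' = push_all v (rev u) o'" for o'
      unfolding v by simp
    then show ?thesis
      using 1 first by (simp add: sort_pass_def pop flip: u_def v_def) (simp add: p_uv)
  next
    \<comment> \<open>\<open>a\<close> directly follows \<open>b\<close>: \<open>b\<close> is popped
      right after \<open>a\<close>, while in \<open>p\<close> it is popped when pushed. Both lead to
      the same state.\<close>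
    case 2
    then have u: "u = u' @ [b]" and v: "v = v'"
      by (auto simp: u_def v_def p)
    have "Min (set v \<union> set (rev u)) = b"
      using b u v by (intro Min_eqI) (auto simp: less_imp_le)
    then have "pop_all v (rev u) o' = pop_all v (rev u') (o' @ [b])" for o'
      by (simp add: u)
    then show ?thesis
      using 2 first push_all_min_first[OF b, of "out @ [a]"]
      by (simp add: sort_pass_def flip: u_def v_def) (simp add: p v u)
  next
    \<comment> \<open>A larger entry covers \<open>b\<close> when \<open>a\<close> is popped, so
      nothing else leaves and the pass returns exactly \<open>p\<close>.\<close>
    case 3
    then obtain k where k: "e = length u' + Suc (Suc k)"
      by (metis add_2_eq_Suc' add_Suc_right add_Suc_shift le_Suc_ex)
    define w where "w = take (Suc k) v'"
    have u: "u = u' @ b # w"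
      by (simp add: u_def w_def p k)
    have v': "v' = w @ v"
      by (simp add: v_def w_def p k)
    have "w \<noteq> []"
      using e by (auto simp: w_def p k)
    then obtain x w' where x: "w = w' @ [x]" by (metis rev_exhaust)
    then have w: "rev u = x # rev w' @ b # rev u'" "b < x"
      using b u v' by auto
    have "pop_all v (rev u) o' = (rev u, o')" for o'
      unfolding w(1) by (rule pop_all_stuck[of b]) (use w in auto)
    moreover have "push_all v (rev u) o' = (rev v @ rev u, o')" for o'
      by (rule push_all_stuck[of b]) (use u b v' in auto)
    ultimately show ?thesis
      using 3 first by (simp add: sort_pass_def flip: u_def v_def) (simp add: p_uv)
  qed
qed

lemma sort_pass_Nil: "(sort_pass ^^ m) ([], out) = ([], out)"
  by (induction m) (auto simp: sort_pass_def)

text \<open>A jump costs a pass of its own; otherwise the pass that outputs \<open>k\<close>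
  continues as the first pass on the rest. Nonemptiness matters: the empty permutation needs no
  pass.\<close>

lemma sort_passes_build:
  assumes "es \<in> insertion_seqs (Suc n)"
  shows "snd ((sort_pass ^^ m) (build k es, out)) = out @ [k..<k + Suc n] \<longleftrightarrow> jumps es < m"
  using assms
proof (induction n arbitrary: es k m out)
  case 0
  have "sort_pass ([k], out) = ([], out @ [k])"
    by (simp add: sort_pass_def)
  then show ?case
    using 0 by (cases m) (auto simp: sort_pass_Nil funpow_Suc_right simp del: funpow.simps)
next
  case (Suc n)
  then obtain e d es' where es: "es = e # d # es'" "e \<le> Suc n" "d # es' \<in> insertion_seqs (Suc n)"
    and d: "d \<le> n" "es' \<in> insertion_seqs n"
    by auto
  let ?p = "build (Suc k) (d # es')" and ?q = "build (Suc (Suc k)) es'"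
  have len: "length es' = n" using d length_insertion_seqs by auto
  have "\<forall>x \<in> set (take d ?q @ drop d ?q). Suc k < x"
    by (simp add: set_build)
  then have pass: "sort_pass (build k es, out) =
      (if d + 2 \<le> e then (?p, out @ [k]) else sort_pass (?p, out @ [k]))"
    using sort_pass_remove_min[of ?p "take d ?q" "Suc k" "drop d ?q" k e out] es d len by simp
  have upt: "out @ [k..<k + Suc (Suc n)] = (out @ [k]) @ [Suc k..<Suc k + Suc n]"
    by (simp add: upt_conv_Cons del: upt_Suc)
  show ?case
  proof (cases m)
    case 0
    then show ?thesis by simp
  next
    case (Suc m')
    have "(sort_pass ^^ m) (build k es, out) =
        (if d + 2 \<le> e then (sort_pass ^^ m') (?p, out @ [k]) else (sort_pass ^^ m) (?p, out @ [k]))"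
      using pass by (simp add: Suc funpow_Suc_right del: funpow.simps build.simps)
    then show ?thesis
      unfolding upt using Suc.IH[OF es(3), of _ "Suc k" "out @ [k]"] es(1) \<open>m = Suc m'\<close>
      by (simp del: build.simps upt_Suc funpow.simps)
  qed
qed

lemma tier_build:
  assumes "es \<in> insertion_seqs n" "n > 0"
  shows "tier (build 1 es) = jumps es"
proof -
  obtain n' where n: "n = Suc n'" using assms by (cases n) auto
  have "passes_needed (build 1 es) = (LEAST m. jumps es < m)"
    using sort_passes_build[of es n' _ 1 "[]"] assms length_insertion_seqs[of es n]
    by (simp add: passes_needed_def n del: upt_Suc)
  also have "\<dots> = Suc (jumps es)"
    by (rule Least_equality) auto
  finally show ?thesis by (simp add: tier_def)
qed

lemma tier_count_eq:
  assumes "n > 0"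
  shows "tier_count n t = card {es \<in> insertion_seqs n. jumps es = t}"
proof -
  have "{1..n} = {1..<1 + n}" by auto
  then have "{p \<in> permutations_of_set {1..n}. tier p = t} =
      build 1 ` {es \<in> insertion_seqs n. jumps es = t}"
    unfolding build_image[of 1 n, symmetric, folded \<open>{1..n} = {1..<1 + n}\<close>]
    using tier_build assms by auto
  moreover have "inj_on (build 1) {es \<in> insertion_seqs n. jumps es = t}"
    by (rule inj_on_subset[OF inj_on_build]) auto
  ultimately show ?thesis
    by (simp add: tier_count_def card_image)
qed

section \<open>Recurrence for the jump polynomials\<close>

definition jump_poly :: "nat \<Rightarrow> rat fps" where
  "jump_poly n = (\<Sum>es\<in>insertion_seqs n. fps_X ^ jumps es)"

text \<open>Prepending \<open>e\<close> creates a jump exactly when the old head is below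
  \<open>e - 1\<close>, so the recursion has to track a bound on the head.\<close>

definition jump_poly_below :: "nat \<Rightarrow> nat \<Rightarrow> rat fps" where
  "jump_poly_below n m = (\<Sum>es\<in>{es \<in> insertion_seqs n. hd es < m}. fps_X ^ jumps es)"

lemma jump_poly_nth: "fps_nth (jump_poly n) t = of_nat (card {es \<in> insertion_seqs n. jumps es = t})"
proof -
  have "fps_nth (jump_poly n) t = (\<Sum>es\<in>insertion_seqs n. if jumps es = t then 1 else 0)"
    by (auto simp: jump_poly_def fps_sum_nth intro!: sum.cong)
  also have "\<dots> = of_nat (card {es \<in> insertion_seqs n. jumps es = t})"
    by (simp flip: sum.inter_filter)
  finally show ?thesis .
qed

lemma sum_insertion_seqs_Suc:
  assumes "m \<le> Suc n"
  shows "(\<Sum>es\<in>{es \<in> insertion_seqs (Suc n). hd es < m}. f es) =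
    (\<Sum>e<m. \<Sum>es\<in>insertion_seqs n. f (e # es))"
proof -
  have "{es \<in> insertion_seqs (Suc n). hd es < m} = (\<lambda>(e, es). e # es) ` ({..<m} \<times> insertion_seqs n)"
    using assms by auto
  moreover have "inj_on (\<lambda>(e, es). e # es) ({..<m} \<times> insertion_seqs n)"
    by (auto simp: inj_on_def)
  ultimately show ?thesis
    by (simp add: sum.reindex sum.cartesian_product case_prod_unfold)
qed

lemma jump_poly_below_Suc_Suc:
  assumes "m \<le> Suc (Suc n)"
  shows "jump_poly_below (Suc (Suc n)) m = of_nat m * jump_poly (Suc n) +
    (fps_X - 1) * (\<Sum>e<m. jump_poly_below (Suc n) (e - 1))"
proof -
  have "(\<Sum>es\<in>insertion_seqs (Suc n). fps_X ^ jumps (e # es)) =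
      jump_poly (Suc n) + (fps_X - 1) * jump_poly_below (Suc n) (e - 1)" for e
  proof -
    have "fps_X ^ jumps (e # es) = (fps_X ^ jumps es :: rat fps) +
        (fps_X - 1) * (if hd es < e - 1 then fps_X ^ jumps es else 0)"
      if "es \<in> insertion_seqs (Suc n)" for es
      using that by (auto simp: algebra_simps)
    then have "(\<Sum>es\<in>insertion_seqs (Suc n). fps_X ^ jumps (e # es)) =
       (\<Sum>es\<in>insertion_seqs (Suc n). (fps_X ^ jumps es :: rat fps) +
        (fps_X - 1) * (if hd es < e - 1 then fps_X ^ jumps es else 0))"
      by (rule sum.cong[OF refl])
    also have "\<dots> = jump_poly (Suc n) + (fps_X - 1) * jump_poly_below (Suc n) (e - 1)"
      unfolding jump_poly_below_def
      by (simp only: sum.distrib jump_poly_def sum.inter_filter finite_insertion_seqs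
        flip: sum_distrib_left)
    finally show ?thesis .
  qed
  then show ?thesis
    unfolding jump_poly_below_def[of "Suc (Suc n)"] sum_insertion_seqs_Suc[OF assms]
    by (simp only: sum.distrib sum_constant card_lessThan flip: sum_distrib_left)
qed

text \<open>Hockey-stick identity; terms with \<open>e < k\<close> are \<open>0 choose k = 0\<close>
  by truncated subtraction.\<close>

lemma sum_choose_diff: "(\<Sum>e<m. (e - k) choose k) = (m - k) choose Suc k" if "k > 0"
proof (induction m)
  case (Suc m)
  then show ?case
    using that by (cases "k \<le> m") (auto simp: Suc_diff_le not_le)
qed simp

text \<open>
  The binomial coefficient counts the sets of \<open>k\<close> positions below \<open>m\<close> with pairwise gaps at least
  two, i.e. the possible runs of \<open>k - 1\<close> marked jumps at the front of the sequence; each jump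
  of weight \<open>w = 1 + (w - 1)\<close> is either unmarked or marked.
\<close>

lemma jump_poly_below_eq:
  assumes "m \<le> Suc n"
  shows "jump_poly_below (Suc n) m =
    (\<Sum>k=1..Suc n. (fps_X - 1) ^ (k - 1) * of_nat ((Suc m - k) choose k) * jump_poly (Suc n - k))"
  using assms
proof (induction n arbitrary: m)
  case 0
  then show ?case
    by (simp add: jump_poly_below_def sum_insertion_seqs_Suc jump_poly_def del: insertion_seqs.simps(2))
next
  case (Suc n)
  have shift: "(Suc (e - 1) - k) choose k = (e - k) choose k" if "k \<ge> 1" for e k :: nat
    using that by (cases e) auto
  have "(\<Sum>e<m. jump_poly_below (Suc n) (e - 1)) =
      (\<Sum>e<m. \<Sum>k=1..Suc n. (fps_X - 1) ^ (k - 1) * of_nat ((e - k) choose k) * jump_poly (Suc n - k))"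
  proof (intro sum.cong refl)
    fix e assume "e \<in> {..<m}"
    then have "e - 1 \<le> Suc n" using Suc.prems by auto
    then show "jump_poly_below (Suc n) (e - 1) =
        (\<Sum>k=1..Suc n. (fps_X - 1) ^ (k - 1) * of_nat ((e - k) choose k) * jump_poly (Suc n - k))"
      unfolding Suc.IH[OF \<open>e - 1 \<le> Suc n\<close>] by (intro sum.cong refl) (simp only: shift atLeastAtMost_iff)
  qed
  also have "\<dots> = (\<Sum>k=1..Suc n. (fps_X - 1) ^ (k - 1) *
      of_nat (\<Sum>e<m. (e - k) choose k) * jump_poly (Suc n - k))"
    by (subst sum.swap) (simp only: of_nat_sum sum_distrib_left sum_distrib_right)
  also have "\<dots> = (\<Sum>k=1..Suc n. (fps_X - 1) ^ (k - 1) *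
      of_nat ((m - k) choose Suc k) * jump_poly (Suc n - k))"
    by (intro sum.cong refl) (simp add: sum_choose_diff)
  finally have "(fps_X - 1) * (\<Sum>e<m. jump_poly_below (Suc n) (e - 1)) =
      (\<Sum>k=1..Suc n. (fps_X - 1) * ((fps_X - 1) ^ (k - 1) * of_nat ((m - k) choose Suc k) * jump_poly (Suc n - k)))"
    by (simp only: sum_distrib_left)
  also have "\<dots> = (\<Sum>k=1..Suc n. (fps_X - 1) ^ k * of_nat ((m - k) choose Suc k) * jump_poly (Suc n - k))"
  proof (intro sum.cong refl)
    fix k assume "k \<in> {1..Suc n}"
    then obtain j where "k = Suc j" by (cases k) auto
    then show "(fps_X - 1) * ((fps_X - 1) ^ (k - 1) * of_nat ((m - k) choose Suc k) * jump_poly (Suc n - k)) =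
        (fps_X - 1) ^ k * of_nat ((m - k) choose Suc k) * jump_poly (Suc n - k)"
      by (simp only: diff_Suc_1 power_Suc mult.assoc)
  qed
  \<comment> \<open>Reindexed, the marked jumps give the terms from \<open>k = 2\<close> on; the
    term \<open>k = 1\<close> is \<open>of_nat m * jump_poly (Suc n)\<close>.\<close>
  also have "\<dots> = (\<Sum>k=Suc 1..Suc (Suc n). (fps_X - 1) ^ (k - 1) *
      of_nat ((Suc m - k) choose k) * jump_poly (Suc (Suc n) - k))"
    by (simp only: sum.shift_bounds_cl_Suc_ivl diff_Suc_Suc diff_Suc_1)
  finally have tail: "(fps_X - 1) * (\<Sum>e<m. jump_poly_below (Suc n) (e - 1)) =
      (\<Sum>k=Suc 1..Suc (Suc n). (fps_X - 1) ^ (k - 1) *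
        of_nat ((Suc m - k) choose k) * jump_poly (Suc (Suc n) - k))" .
  have split: "sum F {1..Suc (Suc n)} = F 1 + sum F {Suc 1..Suc (Suc n)}" for F :: "nat \<Rightarrow> rat fps"
    by (rule sum.atLeast_Suc_atMost) simp
  show ?case
    unfolding jump_poly_below_Suc_Suc[OF Suc.prems] tail split by simp
qed

lemma jump_poly_rec:
  assumes "n > 0"
  shows "jump_poly n =
    (\<Sum>k=1..n. (fps_X - 1) ^ (k - 1) * of_nat ((Suc n - k) choose k) * jump_poly (n - k))"
proof -
  obtain n' where n: "n = Suc n'" using assms by (cases n) auto
  have "jump_poly n = jump_poly_below n n"
    unfolding jump_poly_def jump_poly_below_def n by (intro sum.cong) auto
  then show ?thesis
    using jump_poly_below_eq[of n n'] by (simp add: n)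
qed


section \<open>Iterates of the compositional inverse of \<open>x - x^2\<close>\<close>

fun catalan_iter :: "nat \<Rightarrow> rat fps" where
  "catalan_iter 0 = fps_X"
| "catalan_iter (Suc j) = catalan_iter j oo fps_inv (fps_X - fps_X ^ 2)"

lemma catalan_inverse:
  defines "q \<equiv> fps_X - fps_X ^ 2 :: rat fps"
  shows "fps_nth q 0 = 0" "fps_nth (fps_inv q) 0 = 0"
    "fps_inv q oo q = fps_X" "q oo fps_inv q = fps_X"
proof -
  show q0: "fps_nth q 0 = 0" by (simp add: q_def)
  have q1: "fps_nth q 1 \<noteq> 0" by (simp add: q_def)
  show "fps_nth (fps_inv q) 0 = 0" by (simp add: fps_inv_def)
  show "fps_inv q oo q = fps_X" by (rule fps_inv[OF q0 q1])
  show "q oo fps_inv q = fps_X" by (rule fps_inv_right[OF q0 q1])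
qed

lemma catalan_iter_Suc_compose: "catalan_iter (Suc j) oo (fps_X - fps_X ^ 2) = catalan_iter j"
  by (simp add: catalan_inverse flip: fps_compose_assoc)

text \<open>Here \<open>x - x^2\<close> acts from the outside, as the square roots require;
  \<open>catalan_iter_Suc_compose\<close>, where it acts from the inside, yields the coefficient
  recurrence.\<close>

lemma catalan_iter_Suc_minus_square: "catalan_iter (Suc j) - catalan_iter (Suc j) ^ 2 = catalan_iter j"
proof (induction j)
  case 0
  show ?case
    using catalan_inverse(4)
    by (simp add: fps_compose_sub_distrib catalan_inverse(2) flip: fps_compose_power)
next
  case (Suc j)
  have "catalan_iter (Suc (Suc j)) - catalan_iter (Suc (Suc j)) ^ 2 =
      (catalan_iter (Suc j) - catalan_iter (Suc j) ^ 2) oo fps_inv (fps_X - fps_X ^ 2)"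
    unfolding catalan_iter.simps(2)[of "Suc j"]
    by (simp only: fps_compose_sub_distrib fps_compose_power[OF catalan_inverse(2)])
  also have "\<dots> = catalan_iter (Suc j)"
    unfolding Suc.IH by simp
  finally show ?case .
qed

lemma catalan_iter_nth_0 [simp]: "fps_nth (catalan_iter j) 0 = 0"
  by (induction j) auto

lemma one_minus_fps_X_power_nth:
  "fps_nth ((1 - fps_X) ^ m :: rat fps) k = (-1) ^ k * of_nat (m choose k)"
proof -
  have "(1 - fps_X) ^ m = ((1 + fps_X) ^ m oo (- fps_X) :: rat fps)"
    by (simp add: fps_compose_add_distrib flip: fps_compose_power)
  then show ?thesis
    by (simp add: fps_compose_uminus' fps_binomial_of_nat[symmetric] binomial_gbinomial)
qed

text \<open>Since \<open>x - x^2 = x (1 - x)\<close>, its power \<open>n - k\<close> has coefficient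
  \<open>(-1)^k * ((n - k) choose k)\<close> at \<open>x^n\<close>.\<close>

lemma catalan_iter_nth_rec:
  "fps_nth (catalan_iter j) n =
    (\<Sum>k=0..n. (-1) ^ k * of_nat ((n - k) choose k) * fps_nth (catalan_iter (Suc j)) (n - k))"
proof -
  have pow: "fps_nth ((fps_X - fps_X ^ 2 :: rat fps) ^ (n - k)) n = (-1) ^ k * of_nat ((n - k) choose k)"
    if "k \<le> n" for k
  proof -
    have "(fps_X - fps_X ^ 2 :: rat fps) = fps_X * (1 - fps_X)"
      by (simp add: power2_eq_square algebra_simps)
    then have "(fps_X - fps_X ^ 2 :: rat fps) ^ (n - k) = fps_X ^ (n - k) * (1 - fps_X) ^ (n - k)"
      by (simp add: power_mult_distrib)
    then show ?thesis
      using that by (auto simp: fps_X_power_mult_nth one_minus_fps_X_power_nth)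
  qed
  have "fps_nth (catalan_iter j) n = (\<Sum>i=0..n. fps_nth (catalan_iter (Suc j)) i *
      fps_nth ((fps_X - fps_X ^ 2) ^ i) n)"
    by (subst catalan_iter_Suc_compose[symmetric]) (rule fps_compose_nth)
  also have "\<dots> = (\<Sum>k=0..n. fps_nth (catalan_iter (Suc j)) (n - k) *
      fps_nth ((fps_X - fps_X ^ 2) ^ (n - k)) n)"
    by (rule sum.reindex_bij_witness[of _ "\<lambda>k. n - k" "\<lambda>k. n - k"]) auto
  also have "\<dots> = (\<Sum>k=0..n. (-1) ^ k * of_nat ((n - k) choose k) * fps_nth (catalan_iter (Suc j)) (n - k))"
    by (intro sum.cong refl) (simp add: pow)
  finally show ?thesis .
qed

section \<open>Substitution of \<open>z (1 - w)\<close> and the square roots\<close>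

definition subst_ZW :: "rat fps \<Rightarrow> rat fps fps" where
  "subst_ZW f = Abs_fps (\<lambda>n. fps_const (fps_nth f n) * (1 - fps_X) ^ n)"

lemma subst_ZW_diff: "subst_ZW (f - g) = subst_ZW f - subst_ZW g"
  by (rule fps_ext) (simp add: subst_ZW_def algebra_simps flip: fps_const_sub)

lemma subst_ZW_mult: "subst_ZW (f * g) = subst_ZW f * subst_ZW g"
proof (rule fps_ext)
  fix n
  have "fps_const (sum h A) = (\<Sum>i\<in>A. fps_const (h i))" for h :: "nat \<Rightarrow> rat" and A
    by (rule fps_ext) (simp add: fps_sum_nth)
  then have "fps_nth (subst_ZW (f * g)) n =
      (\<Sum>i=0..n. fps_const (fps_nth f i) * fps_const (fps_nth g (n - i)) * (1 - fps_X) ^ n)"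
    by (simp add: subst_ZW_def fps_mult_nth sum_distrib_right)
  also have "\<dots> = (\<Sum>i=0..n. fps_const (fps_nth f i) * fps_const (fps_nth g (n - i)) *
      ((1 - fps_X) ^ i * (1 - fps_X) ^ (n - i)))"
    by (intro sum.cong refl) (simp flip: power_add)
  also have "\<dots> = fps_nth (subst_ZW f * subst_ZW g) n"
    by (simp only: subst_ZW_def fps_mult_nth fps_nth_Abs_fps mult_ac)
  finally show "fps_nth (subst_ZW (f * g)) n = fps_nth (subst_ZW f * subst_ZW g) n" .
qed

lemma subst_ZW_X: "subst_ZW fps_X = Z * (1 - W)"
proof (rule fps_ext)
  fix n
  have "Z * (1 - W) = fps_X * fps_const (1 - fps_X)"
    by (simp add: Z_def W_def flip: fps_const_sub)
  then show "fps_nth (subst_ZW fps_X) n = fps_nth (Z * (1 - W)) n"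
    by (simp add: subst_ZW_def)
qed

lemma fps_sqrt_eqI:
  assumes "g ^ 2 = f" "fps_nth g 0 = 1"
  shows "fps_sqrt f = g"
proof -
  have "fps_nth f 0 = 1"
    using assms by (auto simp: power2_eq_square)
  from the1_equality[OF fps_sqrt_ex1[OF this]] show ?thesis
    using assms by (simp add: fps_sqrt_def)
qed

text \<open>
  With \<open>\<psi>\<^sub>j = 1 - 2 \<phi>\<^sub>j\<close> the recursion \<open>\<psi>\<^sub>j\<^sub>+\<^sub>1\<^sup>2 = 2 \<psi>\<^sub>j - 1\<close> becomes
  \<open>\<phi>\<^sub>j\<^sub>+\<^sub>1 - \<phi>\<^sub>j\<^sub>+\<^sub>1\<^sup>2 = \<phi>\<^sub>j\<close>.
\<close>

lemma \<psi>_eq: "\<psi> j = 1 - 2 * subst_ZW (catalan_iter j)"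
proof (induction j)
  case 0
  show ?case by (simp add: subst_ZW_X mult.assoc)
next
  case (Suc j)
  \<comment> \<open>This also covers the separate clause for \<open>\<psi> (Suc 0)\<close>, as
    \<open>2 * \<psi> 0 - 1 = 1 - 4 * Z * (1 - W)\<close>.\<close>
  have "\<psi> (Suc j) = fps_sqrt (2 * \<psi> j - 1)"
    by (cases j) (simp_all add: algebra_simps)
  also have "\<dots> = 1 - 2 * subst_ZW (catalan_iter (Suc j))"
  proof (rule fps_sqrt_eqI)
    have "subst_ZW (catalan_iter j) =
        subst_ZW (catalan_iter (Suc j)) - subst_ZW (catalan_iter (Suc j)) ^ 2"
      unfolding power2_eq_square
      by (simp only: catalan_iter_Suc_minus_square[of j, symmetric] power2_eq_square
        subst_ZW_diff subst_ZW_mult)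
    moreover have "(1 - 2 * h) ^ 2 = 2 * (1 - 2 * (h - h ^ 2)) - 1" for h :: "rat fps fps"
      by (simp add: power2_eq_square algebra_simps)
    ultimately show "(1 - 2 * subst_ZW (catalan_iter (Suc j))) ^ 2 = 2 * \<psi> j - 1"
      unfolding Suc.IH by simp
  qed (simp add: subst_ZW_def)
  finally show ?case .
qed

section \<open>Coefficients of the sum over \<open>j\<close>\<close>

lemma fps_mult_one_minus_X_cancel: "(1 - fps_X) * f = (1 - fps_X) * g \<longleftrightarrow> f = g" for f g :: "rat fps"
proof -
  have "fps_nth (1 - fps_X :: rat fps) 0 \<noteq> 0" by simp
  then have "(1 - fps_X :: rat fps) \<noteq> 0" by (metis fps_zero_nth)
  then show ?thesis by simp
qed

text \<open>The division removes one \<open>z\<close> and one factor \<open>1 - w\<close>, whence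
  index \<open>Suc n\<close> but exponent \<open>n\<close>.\<close>

lemma summand_nth:
  "fps_nth ((\<psi> j - \<psi> (Suc j)) / (2 * Z * (1 - W)) * W ^ j) n =
    fps_const (fps_nth (catalan_iter (Suc j) - catalan_iter j) (Suc n)) * (1 - fps_X) ^ n * fps_X ^ j"
proof -
  define f where "f = catalan_iter (Suc j) - catalan_iter j"
  define q where "q = (\<psi> j - \<psi> (Suc j)) / (2 * Z * (1 - W))"
  have eq: "\<psi> j - \<psi> (Suc j) = 2 * subst_ZW f"
    by (simp add: \<psi>_eq f_def subst_ZW_diff algebra_simps del: catalan_iter.simps)
  have "fps_nth (\<psi> j - \<psi> (Suc j)) 0 = 0"
    unfolding eq by (simp add: subst_ZW_def f_def)
  from mult_divide_2ZW[OF this] have "2 * (Z * (1 - W) * q) = 2 * subst_ZW f"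
    unfolding eq by (simp add: q_def eq mult.assoc)
  then have "Z * (1 - W) * q = subst_ZW f"
    by simp
  moreover have "Z * (1 - W) * q = fps_X * (fps_const (1 - fps_X) * q)"
    by (simp add: Z_def W_def mult.assoc flip: fps_const_sub)
  ultimately have "fps_nth (fps_X * (fps_const (1 - fps_X) * q)) (Suc n) = fps_nth (subst_ZW f) (Suc n)"
    by simp
  then have "(1 - fps_X) * fps_nth q n = (1 - fps_X) * (fps_const (fps_nth f (Suc n)) * (1 - fps_X) ^ n)"
    by (simp add: subst_ZW_def mult_ac del: mult_cancel_left mult_cancel_right)
  then have "fps_nth q n = fps_const (fps_nth f (Suc n)) * (1 - fps_X) ^ n"
    by (simp only: fps_mult_one_minus_X_cancel)
  moreover have "W ^ j = fps_const (fps_X ^ j)"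
    by (simp add: W_def fps_const_power)
  ultimately show ?thesis
    unfolding q_def[symmetric] f_def[symmetric] by (simp only: fps_mult_right_const_nth)
qed

text \<open>Coefficient \<open>k\<close> of the partial sums is constant once
  \<open>N > k\<close>.\<close>

lemma fps_const_mult_X_power_sums:
  fixes c :: "nat \<Rightarrow> rat" and g :: "rat fps"
  shows "(\<lambda>j. fps_const (c j) * g * fps_X ^ j) sums (g * Abs_fps c)"
  unfolding sums_def
proof (rule tendsto_fpsI)
  fix k
  show "\<forall>\<^sub>F N in sequentially. fps_nth (\<Sum>j<N. fps_const (c j) * g * fps_X ^ j) k = fps_nth (g * Abs_fps c) k"
    using eventually_gt_at_top[of k]
  proof eventually_elim
    case (elim N)
    have "fps_nth (\<Sum>j<N. fps_const (c j) * g * fps_X ^ j) k =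
        (\<Sum>j<N. if j \<le> k then c j * fps_nth g (k - j) else 0)"
      by (auto simp: fps_sum_nth fps_X_power_mult_right_nth intro!: sum.cong)
    also have "\<dots> = (\<Sum>j=0..k. c j * fps_nth g (k - j))"
      using elim by (intro sum.mono_neutral_cong_right) auto
    also have "\<dots> = fps_nth (Abs_fps c * g) k"
      by (simp add: fps_mult_nth)
    finally show ?case by (simp add: mult.commute)
  qed
qed

text \<open>The coefficient of \<open>x^n\<close> in \<open>G(x)\<close>, as a series in
  \<open>w\<close>.\<close>

definition iter_gf :: "nat \<Rightarrow> rat fps" where
  "iter_gf n = Abs_fps (\<lambda>j. fps_nth (catalan_iter (Suc j)) n)"

lemma iter_gf_0 [simp]: "iter_gf 0 = 0"
  by (simp add: iter_gf_def fps_eq_iff del: catalan_iter.simps)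

lemma iter_gf_shift:
  "Abs_fps (\<lambda>j. fps_nth (catalan_iter j) n) = (if n = 1 then 1 else 0) + fps_X * iter_gf n"
proof (rule fps_ext)
  fix j
  show "fps_nth (Abs_fps (\<lambda>j. fps_nth (catalan_iter j) n)) j =
      fps_nth ((if n = 1 then 1 else 0) + fps_X * iter_gf n) j"
    by (cases j) (auto simp: iter_gf_def simp del: catalan_iter.simps(2))
qed

text \<open>The coefficient of \<open>x^n\<close> in \<open>x + w G(x) = G(x - x^2)\<close>.\<close>

lemma iter_gf_rec:
  "(if n = 1 then 1 else 0) + fps_X * iter_gf n =
    (\<Sum>k=0..n. (-1) ^ k * of_nat ((n - k) choose k) * iter_gf (n - k))"
proof -
  have c: "fps_nth ((-1) ^ k * of_nat a * f) j = (-1) ^ k * of_nat a * fps_nth f j" for k a j and f :: "rat fps"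
  proof -
    have "(-1) ^ k * of_nat a * f = fps_const ((-1) ^ k * of_nat a) * f"
      by (simp add: fps_of_nat flip: fps_const_mult fps_const_power fps_const_neg)
    then show ?thesis by (simp only: fps_mult_left_const_nth)
  qed
  show ?thesis
    unfolding iter_gf_shift[symmetric]
    by (rule fps_ext, simp only: fps_sum_nth c iter_gf_def fps_nth_Abs_fps catalan_iter_nth_rec[of _ n])
qed

lemma iter_gf_eq: "(1 - fps_X) ^ Suc n * iter_gf (Suc n) = jump_poly n"
proof (induction n rule: less_induct)
  case (less n)
  have "(1 - fps_X) * iter_gf (Suc n) = (if n = 0 then 1 else 0) -
      (\<Sum>k=1..Suc n. (-1) ^ k * of_nat ((Suc n - k) choose k) * iter_gf (Suc n - k))"
    using iter_gf_rec[of "Suc n"]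
    by (simp add: sum.atLeast_Suc_atMost[of 0] algebra_simps)
  also have "(\<Sum>k=1..Suc n. (-1) ^ k * of_nat ((Suc n - k) choose k) * iter_gf (Suc n - k)) =
      (\<Sum>k=1..n. (-1) ^ k * of_nat ((Suc n - k) choose k) * iter_gf (Suc n - k))"
    by simp
  finally have eq: "(1 - fps_X) * iter_gf (Suc n) = (if n = 0 then 1 else 0) -
      (\<Sum>k=1..n. (-1) ^ k * of_nat ((Suc n - k) choose k) * iter_gf (Suc n - k))" .
  show ?case
  proof (cases "n = 0")
    case True
    then show ?thesis using eq by (simp add: jump_poly_def)
  next
    case False
    have "(1 - fps_X) ^ Suc n * iter_gf (Suc n) =
      (1 - fps_X) ^ n * ((1 - fps_X) * iter_gf (Suc n))"
      by (simp only: power_Suc2 mult.assoc)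
    also have "\<dots> =
      (\<Sum>k=1..n. (1 - fps_X) ^ n * (- ((-1) ^ k * of_nat ((Suc n - k) choose k) * iter_gf (Suc n - k))))"
      by (simp only: eq False if_False diff_0 mult_minus_right sum_negf sum_distrib_left)
    also have "\<dots> = (\<Sum>k=1..n. (fps_X - 1) ^ (k - 1) * of_nat ((Suc n - k) choose k) * jump_poly (n - k))"
    proof (intro sum.cong refl)
      fix k assume k: "k \<in> {1..n}"
      then obtain i where i: "k = Suc i" by (cases k) auto
      \<comment> \<open>Of the \<open>n\<close> factors \<open>1 - w\<close>, \<open>k - 1\<close>
        absorb the signs into \<open>(fps_X - 1) ^ (k - 1)\<close>; the other
        \<open>n - k + 1\<close> complete \<open>jump_poly (n - k)\<close>.\<close>
      have "(fps_X - 1 :: rat fps) ^ i = (-1) ^ i * (1 - fps_X) ^ i"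
        by (simp flip: power_mult_distrib)
      moreover have "(1 - fps_X :: rat fps) ^ n = (1 - fps_X) ^ i * (1 - fps_X) ^ Suc (n - k)"
        using k i by (simp flip: power_add power_Suc)
      moreover have "jump_poly (n - k) = (1 - fps_X) ^ Suc (n - k) * iter_gf (Suc n - k)"
        using less[of "n - k"] k by (simp add: Suc_diff_le)
      ultimately show "(1 - fps_X) ^ n * (- ((-1) ^ k * of_nat ((Suc n - k) choose k) * iter_gf (Suc n - k))) =
          (fps_X - 1) ^ (k - 1) * of_nat ((Suc n - k) choose k) * jump_poly (n - k)"
        by (simp only: i diff_Suc_1) (simp add: mult_ac)
    qed
    finally show ?thesis using jump_poly_rec False by simp
  qed
qed

theorem theorem4p12:
  shows "\<forall>n. (\<lambda>j. fps_nth ((\<psi> j - \<psi> (Suc j)) / (2 * Z * (1 - W)) * W ^ j) n) sums fps_nth tier_gf n"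
proof
  fix n
  define c where "c = (\<lambda>j. fps_nth (catalan_iter (Suc j) - catalan_iter j) (Suc n))"
  have "Abs_fps c = iter_gf (Suc n) - Abs_fps (\<lambda>j. fps_nth (catalan_iter j) (Suc n))"
    by (simp add: c_def iter_gf_def fps_eq_iff del: catalan_iter.simps)
  also have "\<dots> = (1 - fps_X) * iter_gf (Suc n) - (if n = 0 then 1 else 0)"
    unfolding iter_gf_shift by (simp add: algebra_simps)
  finally have eq: "Abs_fps c = (1 - fps_X) * iter_gf (Suc n) - (if n = 0 then 1 else 0)" .
  have "(1 - fps_X) ^ n * Abs_fps c = (1 - fps_X) ^ Suc n * iter_gf (Suc n) - (if n = 0 then 1 else 0)"
    unfolding eq by (simp add: right_diff_distrib mult_ac)
  \<comment> \<open>At \<open>n = 0\<close> the subtracted \<open>1\<close> cancels the empty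
    sequence, which \<open>tier_gf\<close> leaves out.\<close>
  also have "\<dots> = fps_nth tier_gf n"
    unfolding iter_gf_eq
  proof (cases "n = 0")
    case False
    then show "jump_poly n - (if n = 0 then 1 else 0) = fps_nth tier_gf n"
      by (simp add: tier_gf_def fps_eq_iff jump_poly_nth tier_count_eq)
  qed (simp add: tier_gf_def jump_poly_def)
  finally show "(\<lambda>j. fps_nth ((\<psi> j - \<psi> (Suc j)) / (2 * Z * (1 - W)) * W ^ j) n) sums fps_nth tier_gf n"
    using fps_const_mult_X_power_sums[of c "(1 - fps_X) ^ n"] unfolding summand_nth c_def by (simp only:)
qed

end
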